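(* Every Invariant Graphon Network (IWN) is an instance of IGN-small. That is, let $\mathcal N$ be an IWN, regarded as a continuous IGN, and for $n\in\mathbb N$ let $\mathcal N^{(n)}$ be its discrete version at resolution $n$. Then for every $n\in\mathbb N$ and every $(W,f)\in\mathcal{WS}_r$ such that $W$ is a regular step function on $[0,1]^2$ at resolution $n$ and $f$ is a regular step function on $[0,1]$ at resolution $n$, $$(S^{(n)}\circ\mathcal N)(W,f)=(\mathcal N^{(n)}\circ S^{(n)})(W,f).$$
   Context: $\mathcal{WS}_r$ ($r>0$) is the set of pairs $(W,f)$ with $W:[0,1]^2\to[0,1]$ symmetric measurable and $f\in L^\infty[0,1]$, $\|f\|_\infty\le r$. Equivariant layers. $\mathsf{LE}_{k\to\ell}$ is the space of bounded linear operators $T:L^2([0,1]^k)\to L^2([0,1]^\ell)$ ($L^2([0,1]^0)=\mathbb R$) with $T(U^\varphi)=T(U)^\varphi$ a.e. for all $U$ and all measure preserving $\varphi:[0,1]\to[0,1]$, where $U^\varphi(x_1,\dots,x_k)=U(\varphi(x_1),\dots,\varphi(x_k))$. IGN basis. Let $\Gamma_{m}$ be the set of partitions of $[m]$. Given $\gamma\in\Gamma_{k+\ell}$, where $1,\dots,k$ stand for input axes and $k+1,\dots,k+\ell$ for output axes, let $\gamma_1=\{A\in\gamma: A\subseteq[k]\}$, $\gamma_2=\{A\in\gamma:A\subseteq k+[\ell]\}$, $\gamma_3=\gamma\setminus(\gamma_1\cup\gamma_2)$. Define $T_\gamma$ on functions $U$ on $[0,1]^k$ as follows: for $\boldsymbol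 y\in[0,1]^\ell$, if $y_j\neq y_{j'}$ for some $k+j,k+j'$ in the same block of $\gamma$, then $T_\gamma(U)(\boldsymbol y)=0$; otherwise $T_\gamma(U)(\boldsymbol y)=\int_{[0,1]^{\gamma_1}}U(\boldsymbol x)\,d\boldsymbol z$, where $x_i=z_A$ if $i\in A\in\gamma_1$ and $x_i=y_j$ if $i$ and $k+j$ lie in a common block $A\in\gamma_3$. The discrete version $T_\gamma^{(n)}:\mathbb R^{n^k}\to\mathbb R^{n^\ell}$ is defined by the same formula with $[0,1]$ replaced by $[n]$ and the integral by the average $n^{-|\gamma_1|}\sum_{\boldsymbol z\in[n]^{\gamma_1}}$. The space $\mathsf{LE}_{k\to\ell}$ has as a basis those $T_\gamma$ for which every $A\in\gamma$ satisfies $|A\cap[k]|\le1$ and $|A\cap(k+[\ell])|\le1$. Networks. Let $\varrho:\mathbb R\to\mathbb R$. A continuous IGN is a map $\mathcal N=\mathfrak T^{(S)}\circ\varrho\circ\cdots\circ\varrho\circ\mathfrak T^{(1)}$, where, for orders $k_s\in\mathbb N_0$ and widths $d_s\in\mathbb N$ ($0\le s\le S$) with $(d_0,k_0)=(2,2)$, the layer $\mathfrak T^{(s)}$ maps a $d_{s-1}$-tuple $\boldsymbol U$ of functions on $[0,1]^{k_{s-1}}$ to the $d_s$-tuple of functions on $[0,1]^{k_s}$ with components $\sum_j T^{(s)}_{ij}(\boldsymbol U_j)+b^{(s)}_i$, each $T^{(s)}_{ij}$ being a linear combination of the $T_\gamma$, $\gamma\in\Gamma_{k_{s-1}+k_s}$,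 and each $b^{(s)}_i$ a linear combination of the $T_\gamma(1)$, $\gamma\in\Gamma_{0+k_s}$; $\varrho$ acts pointwise. The input $(W,f)$ is identified with $(x,y)\mapsto(W(x,y),f(x))$. An IWN is such a network with all $T^{(s)}_{ij}\in\mathsf{LE}_{k_{s-1}\to k_s}$, all $b_i^{(s)}\in\mathsf{LE}_{0\to k_s}$ (i.e. constant functions), and $(d_S,k_S)=(1,0)$, so the output is a scalar. The discrete version $\mathcal N^{(n)}$ is obtained by replacing every $T_\gamma$ by $T_\gamma^{(n)}$ (same coefficients). Grid sampling. $S^{(n)}$ sends a (vector-valued) function $U$ on $[0,1]^k$ to the tensor $(U(i_1/n,\dots,i_k/n))_{i_1,\dots,i_k\in[n]}$ (identity on scalars when $k=0$); $S^{(n)}(W,f)$ is the sampling of $(x,y)\mapsto(W(x,y),f(x))$. A regular step function at resolution $n$ on $[0,1]^k$ is a function constant on each product of the $n$ cells $[0,1/n],(1/n,2/n],\dots,((n-1)/n,1]$. IGN-small is the class of continuous IGNs $\mathcal N$ satisfying the displayed commutation identity for all $n$ and all such step graphon-signals. *)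

theory Defs
  imports "HOL-Analysis.Analysis" "HOL-Library.Disjoint_Sets"
begin

text \<open>
  A point of \<open>P ^ k\<close> is an extensional function in \<open>{..<k} \<rightarrow>\<^sub>E P\<close>, so axes are numbered from 0.
  In a partition of \<open>{..<k + l}\<close> the numbers \<open>i < k\<close> are the input axes and the numbers
  \<open>k + j\<close> with \<open>j < l\<close> are the output axes.
\<close>

section \<open>Equivariant layers\<close>

abbreviation unit_interval :: "real measure" where
  "unit_interval \<equiv> restrict_space lborel {0..1}"

definition cube :: "nat \<Rightarrow> (nat \<Rightarrow> real) measure" where
  "cube k = PiM {..<k} (\<lambda>_. unit_interval)"

text \<open>
  Elements of \<open>L\<^sup>2\<close> are handled through Borel measurable representatives, up to equality almost
  everywhere. On \<open>[0,1]\<^sup>0\<close>, a single point of mass 1, this gives the real numbers.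
\<close>

definition L2 :: "nat \<Rightarrow> ((nat \<Rightarrow> real) \<Rightarrow> real) set" where
  "L2 k = {U \<in> borel_measurable (cube k). integrable (cube k) (\<lambda>x. (U x)\<^sup>2)}"

definition L2_norm :: "nat \<Rightarrow> ((nat \<Rightarrow> real) \<Rightarrow> real) \<Rightarrow> real" where
  "L2_norm k U = sqrt (\<integral>x. (U x)\<^sup>2 \<partial>cube k)"

definition measure_preserving_map :: "(real \<Rightarrow> real) \<Rightarrow> bool" where
  "measure_preserving_map \<phi> \<longleftrightarrow>
     \<phi> \<in> measurable unit_interval unit_interval \<and> distr unit_interval unit_interval \<phi> = unit_interval"

definition pullback :: "(real \<Rightarrow> real) \<Rightarrow> nat \<Rightarrow> ((nat \<Rightarrow> real) \<Rightarrow> real) \<Rightarrow> (nat \<Rightarrow> real) \<Rightarrow> real" where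
  "pullback \<phi> k U = (\<lambda>x. U (\<lambda>i\<in>{..<k}. \<phi> (x i)))"

text \<open>
  Operators act on representatives; the first two conditions say that \<open>T\<close> induces a map
  on the classes modulo almost-everywhere equality.
\<close>

definition LE :: "nat \<Rightarrow> nat \<Rightarrow> (((nat \<Rightarrow> real) \<Rightarrow> real) \<Rightarrow> (nat \<Rightarrow> real) \<Rightarrow> real) set" where
  "LE k l = {T.
     (\<forall>U\<in>L2 k. T U \<in> L2 l) \<and>
     (\<forall>U\<in>L2 k. \<forall>V\<in>L2 k. (AE x in cube k. U x = V x) \<longrightarrow> (AE y in cube l. T U y = T V y)) \<and>
     (\<forall>U\<in>L2 k. \<forall>V\<in>L2 k. AE y in cube l. T (\<lambda>x. U x + V x) y = T U y + T V y) \<and>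
     (\<forall>a. \<forall>U\<in>L2 k. AE y in cube l. T (\<lambda>x. a * U x) y = a * T U y) \<and>
     (\<exists>C. \<forall>U\<in>L2 k. L2_norm l (T U) \<le> C * L2_norm k U) \<and>
     (\<forall>\<phi>. measure_preserving_map \<phi> \<longrightarrow>
        (\<forall>U\<in>L2 k. AE y in cube l. T (pullback \<phi> k U) y = pullback \<phi> l (T U) y))}"

section \<open>The operators \<open>T\<^sub>\<gamma>\<close>\<close>

definition input_blocks :: "nat \<Rightarrow> nat set set \<Rightarrow> nat set set" where
  "input_blocks k \<gamma> = {A \<in> \<gamma>. A \<subseteq> {..<k}}"

definition block_of :: "nat set set \<Rightarrow> nat \<Rightarrow> nat set" where
  "block_of \<gamma> i = (THE A. A \<in> \<gamma> \<and> i \<in> A)"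

text \<open>
  The point \<open>x\<close> with \<open>x\<^sub>i = z\<^sub>A\<close> or \<open>x\<^sub>i = y\<^sub>j\<close>. It is only used if \<open>y\<close> is constant on the output
  axes of each block, so that any \<open>j\<close> with \<open>k + j\<close> in the block of \<open>i\<close> gives the same value.
\<close>

definition glue :: "nat \<Rightarrow> nat set set \<Rightarrow> (nat set \<Rightarrow> 'p) \<Rightarrow> (nat \<Rightarrow> 'p) \<Rightarrow> nat \<Rightarrow> 'p" where
  "glue k \<gamma> z y = (\<lambda>i\<in>{..<k}.
     if block_of \<gamma> i \<in> input_blocks k \<gamma> then z (block_of \<gamma> i)
     else y (LEAST j. k + j \<in> block_of \<gamma> i))"

text \<open>
  The common formula for the continuous and the discrete operators: \<open>mean B g\<close> stands for the
  mean of \<open>g z\<close> over the tuples \<open>z\<close> of points indexed by the set \<open>B\<close> of blocks.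
\<close>

definition T_formula ::
  "(nat set set \<Rightarrow> ((nat set \<Rightarrow> 'p) \<Rightarrow> real) \<Rightarrow> real) \<Rightarrow> nat \<Rightarrow> nat \<Rightarrow> nat set set \<Rightarrow>
     ((nat \<Rightarrow> 'p) \<Rightarrow> real) \<Rightarrow> (nat \<Rightarrow> 'p) \<Rightarrow> real" where
  "T_formula mean k l \<gamma> U y =
     (if \<exists>A\<in>\<gamma>. \<exists>j<l. \<exists>j'<l. k + j \<in> A \<and> k + j' \<in> A \<and> y j \<noteq> y j' then 0
      else mean (input_blocks k \<gamma>) (\<lambda>z. U (glue k \<gamma> z y)))"

definition T_cont ::
  "nat \<Rightarrow> nat \<Rightarrow> nat set set \<Rightarrow> ((nat \<Rightarrow> real) \<Rightarrow> real) \<Rightarrow> (nat \<Rightarrow> real) \<Rightarrow> real" where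
  "T_cont = T_formula (\<lambda>B g. \<integral>z. g z \<partial>PiM B (\<lambda>_. unit_interval))"

definition T_disc ::
  "nat \<Rightarrow> nat \<Rightarrow> nat \<Rightarrow> nat set set \<Rightarrow> ((nat \<Rightarrow> nat) \<Rightarrow> real) \<Rightarrow> (nat \<Rightarrow> nat) \<Rightarrow> real" where
  "T_disc n = T_formula (\<lambda>B g. (\<Sum>z\<in>B \<rightarrow>\<^sub>E {1..n}. g z) / real n ^ card B)"

section \<open>Networks\<close>

text \<open>
  A family \<open>T\<close> stands for either \<open>T_cont\<close> or \<open>T_disc n\<close>, and \<open>c\<close> for the coefficients of a
  linear combination of the \<open>T\<^sub>\<gamma>\<close>.
\<close>

definition lin_comb ::
  "(nat \<Rightarrow> nat \<Rightarrow> nat set set \<Rightarrow> ((nat \<Rightarrow> 'p) \<Rightarrow> real) \<Rightarrow> (nat \<Rightarrow> 'p) \<Rightarrow> real) \<Rightarrow>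
     nat \<Rightarrow> nat \<Rightarrow> (nat set set \<Rightarrow> real) \<Rightarrow> ((nat \<Rightarrow> 'p) \<Rightarrow> real) \<Rightarrow> (nat \<Rightarrow> 'p) \<Rightarrow> real" where
  "lin_comb T k l c U y = (\<Sum>\<gamma> | partition_on {..<k + l} \<gamma>. c \<gamma> * T k l \<gamma> U y)"

text \<open>
  \<open>weight N s i j\<close> and \<open>bias N s i\<close> hold the coefficients of \<open>T\<^sup>(\<^sup>s\<^sup>)\<^sub>i\<^sub>j\<close> and \<open>b\<^sup>(\<^sup>s\<^sup>)\<^sub>i\<close>, used for
  \<open>1 \<le> s \<le> depth N\<close>, \<open>i < width N s\<close> and \<open>j < width N (s - 1)\<close>.
\<close>

record ign =
  depth :: nat
  order :: "nat \<Rightarrow> nat"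
  width :: "nat \<Rightarrow> nat"
  weight :: "nat \<Rightarrow> nat \<Rightarrow> nat \<Rightarrow> nat set set \<Rightarrow> real"
  bias :: "nat \<Rightarrow> nat \<Rightarrow> nat set set \<Rightarrow> real"

definition continuous_IGN :: "ign set" where
  "continuous_IGN = {N. 1 \<le> depth N \<and> width N 0 = 2 \<and> order N 0 = 2 \<and> (\<forall>s\<le>depth N. 1 \<le> width N s)}"

definition layer ::
  "(nat \<Rightarrow> nat \<Rightarrow> nat set set \<Rightarrow> ((nat \<Rightarrow> 'p) \<Rightarrow> real) \<Rightarrow> (nat \<Rightarrow> 'p) \<Rightarrow> real) \<Rightarrow> ign \<Rightarrow> nat \<Rightarrow>
     (nat \<Rightarrow> (nat \<Rightarrow> 'p) \<Rightarrow> real) \<Rightarrow> nat \<Rightarrow> (nat \<Rightarrow> 'p) \<Rightarrow> real" where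
  "layer T N s U i y =
     (\<Sum>j<width N (s - 1). lin_comb T (order N (s - 1)) (order N s) (weight N s i j) (U j) y)
     + lin_comb T 0 (order N s) (bias N s i) (\<lambda>_. 1) y"

fun forward ::
  "(nat \<Rightarrow> nat \<Rightarrow> nat set set \<Rightarrow> ((nat \<Rightarrow> 'p) \<Rightarrow> real) \<Rightarrow> (nat \<Rightarrow> 'p) \<Rightarrow> real) \<Rightarrow> (real \<Rightarrow> real) \<Rightarrow>
     ign \<Rightarrow> nat \<Rightarrow> (nat \<Rightarrow> (nat \<Rightarrow> 'p) \<Rightarrow> real) \<Rightarrow> nat \<Rightarrow> (nat \<Rightarrow> 'p) \<Rightarrow> real" where
  "forward T \<rho> N 0 U = U"
| "forward T \<rho> N (Suc 0) U = layer T N (Suc 0) U"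
| "forward T \<rho> N (Suc (Suc s)) U =
     layer T N (Suc (Suc s)) (\<lambda>j y. \<rho> (forward T \<rho> N (Suc s) U j y))"

definition ign_map ::
  "(real \<Rightarrow> real) \<Rightarrow> ign \<Rightarrow> (nat \<Rightarrow> (nat \<Rightarrow> real) \<Rightarrow> real) \<Rightarrow> nat \<Rightarrow> (nat \<Rightarrow> real) \<Rightarrow> real" where
  "ign_map \<rho> N = forward T_cont \<rho> N (depth N)"

definition ign_map_disc ::
  "nat \<Rightarrow> (real \<Rightarrow> real) \<Rightarrow> ign \<Rightarrow> (nat \<Rightarrow> (nat \<Rightarrow> nat) \<Rightarrow> real) \<Rightarrow> nat \<Rightarrow> (nat \<Rightarrow> nat) \<Rightarrow> real" where
  "ign_map_disc n \<rho> N = forward (T_disc n) \<rho> N (depth N)"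

text \<open>
  \<open>LE\<close> does not see the \<open>T\<^sub>\<gamma>\<close> that vanish almost everywhere (those where a block contains two
  output axes), whereas their discrete versions do not vanish. The coefficients of an element of
  \<open>LE\<close>, used in the discrete version, are those of its expansion in the basis of \<open>LE\<close>; so a
  null \<open>T\<^sub>\<gamma>\<close> must not occur in the linear combination. That no \<open>T\<^sub>\<gamma>\<close> with two input axes
  in one block occurs either is then a consequence of the membership in \<open>LE\<close>.
\<close>

definition null_operator :: "nat \<Rightarrow> nat \<Rightarrow> nat set set \<Rightarrow> bool" where
  "null_operator k l \<gamma> \<longleftrightarrow> (\<forall>U\<in>L2 k. AE y in cube l. T_cont k l \<gamma> U y = 0)"

definition expansion_in_LE :: "nat \<Rightarrow> nat \<Rightarrow> (nat set set \<Rightarrow> real) \<Rightarrow> bool" where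
  "expansion_in_LE k l c \<longleftrightarrow>
     lin_comb T_cont k l c \<in> LE k l \<and>
     (\<forall>\<gamma>. partition_on {..<k + l} \<gamma> \<and> null_operator k l \<gamma> \<longrightarrow> c \<gamma> = 0)"

text \<open>
  The bias \<open>b \<in> LE\<^sub>0\<^sub>\<rightarrow>\<^sub>k\<close> is identified with the function \<open>b(1)\<close>, which \<open>layer\<close> adds.
\<close>

definition IWN :: "ign set" where
  "IWN = {N \<in> continuous_IGN.
     width N (depth N) = 1 \<and> order N (depth N) = 0 \<and>
     (\<forall>s\<in>{1..depth N}. \<forall>i<width N s.
        (\<forall>j<width N (s - 1). expansion_in_LE (order N (s - 1)) (order N s) (weight N s i j)) \<and>
        expansion_in_LE 0 (order N s) (bias N s i))}"

section \<open>Graphon-signals and sampling\<close>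

definition WS :: "real \<Rightarrow> ((real \<Rightarrow> real \<Rightarrow> real) \<times> (real \<Rightarrow> real)) set" where
  "WS r = {(W, f).
     (\<lambda>(x, y). W x y) \<in> borel_measurable (lebesgue_on ({0..1} \<times> {0..1})) \<and>
     (\<forall>x\<in>{0..1}. \<forall>y\<in>{0..1}. W x y \<in> {0..1} \<and> W x y = W y x) \<and>
     f \<in> borel_measurable (lebesgue_on {0..1}) \<and> (AE x in lebesgue_on {0..1}. \<bar>f x\<bar> \<le> r)}"

definition input :: "(real \<Rightarrow> real \<Rightarrow> real) \<times> (real \<Rightarrow> real) \<Rightarrow> nat \<Rightarrow> (nat \<Rightarrow> real) \<Rightarrow> real" where
  "input = (\<lambda>(W, f) i x. if i = 0 then W (x 0) (x 1) else f (x 0))"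

definition sample :: "nat \<Rightarrow> nat \<Rightarrow> (nat \<Rightarrow> (nat \<Rightarrow> real) \<Rightarrow> real) \<Rightarrow> nat \<Rightarrow> (nat \<Rightarrow> nat) \<Rightarrow> real" where
  "sample n k U i m = U i (\<lambda>a\<in>{..<k}. real (m a) / real n)"

definition grid_cell :: "nat \<Rightarrow> nat \<Rightarrow> real set" where
  "grid_cell n m =
     (if m = 1 then {0..1 / real n} else {real (m - 1) / real n<..real m / real n})"

definition regular_step :: "nat \<Rightarrow> nat \<Rightarrow> ((nat \<Rightarrow> real) \<Rightarrow> real) \<Rightarrow> bool" where
  "regular_step n k U \<longleftrightarrow>
     (\<forall>m\<in>{..<k} \<rightarrow>\<^sub>E {1..n}. \<exists>c. \<forall>x\<in>(\<Pi>\<^sub>E a\<in>{..<k}. grid_cell n (m a)). U x = c)"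

text \<open>
  Both sides of the commutation identity are tuples of tensors, compared entrywise; if the output
  order is 0 there is exactly one multi-index \<open>m\<close> and the entries are scalars.
\<close>

definition IGN_small :: "(real \<Rightarrow> real) \<Rightarrow> real \<Rightarrow> ign set" where
  "IGN_small \<rho> r = {N \<in> continuous_IGN.
     \<forall>n\<ge>1. \<forall>(W, f)\<in>WS r.
       regular_step n 2 (\<lambda>x. W (x 0) (x 1)) \<and> regular_step n 1 (\<lambda>x. f (x 0)) \<longrightarrow>
       (\<forall>i<width N (depth N). \<forall>m\<in>{..<order N (depth N)} \<rightarrow>\<^sub>E {1..n}.
          sample n (order N (depth N)) (ign_map \<rho> N (input (W, f))) i m =
          ign_map_disc n \<rho> N (sample n 2 (input (W, f))) i m)}"

end

theory Submission
  imports Defs "HOL-Probability.Probability_Measure"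
begin

text \<open>
  If no block of \<open>\<gamma>\<close> contains two output axes, then \<open>T\<^sub>\<gamma>\<close> maps regular step functions to regular
  step functions, and on them the integral is the average over the grid cells, so \<open>T\<^sub>\<gamma>\<close> commutes
  with sampling; blocks with several input axes do no harm. If some block contains two output axes,
  then \<open>T\<^sub>\<gamma>\<close> is supported on a diagonal and hence null, so its coefficient vanishes. The pointwise
  nonlinearity preserves step functions, and the claim follows layer by layer.
\<close>

section \<open>Grid cells\<close>

text \<open>The number of the cell containing \<open>x\<close>. The ceiling matches cells that are
  closed on the right, and \<open>max 1\<close> puts \<open>x = 0\<close> into the first cell, the
  only one that contains its left endpoint.\<close>

definition cell_index :: "nat \<Rightarrow> real \<Rightarrow> nat" where
  "cell_index n x = max 1 (nat \<lceil>real n * x\<rceil>)"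

lemma cell_index_in_range:
  assumes "n \<ge> 1" and "x \<in> {0..1}"
  shows "cell_index n x \<in> {1..n}"
proof -
  have "real n * x \<le> real n"
    using assms by (simp add: mult_left_le)
  then have "\<lceil>real n * x\<rceil> \<le> int n"
    by (simp add: ceiling_le_iff)
  then show ?thesis
    using assms by (simp add: cell_index_def nat_le_iff)
qed

lemma mem_grid_cell_iff:
  assumes "n \<ge> 1" and "x \<in> {0..1}" and "m \<in> {1..n}"
  shows "x \<in> grid_cell n m \<longleftrightarrow> cell_index n x = m"
proof (cases "m = 1")
  case True
  have "x \<le> 1 / real n \<longleftrightarrow> real n * x \<le> 1"
    using assms(1) by (simp add: field_simps)
  also have "\<dots> \<longleftrightarrow> \<lceil>real n * x\<rceil> \<le> 1"
    by (simp add: ceiling_le_iff)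
  \<comment> \<open>\<open>nat\<close> and \<open>max 1\<close> send every ceiling \<le> 1 to the
    index 1.\<close>
  also have "\<dots> \<longleftrightarrow> cell_index n x = 1"
    unfolding cell_index_def by linarith
  finally show ?thesis
    using True assms(2) by (simp add: grid_cell_def)
next
  case False
  then have m: "m \<ge> 2" "real (m - 1) = real m - 1"
    using assms(3) by auto
  have "x \<in> grid_cell n m \<longleftrightarrow> real m - 1 < real n * x \<and> real n * x \<le> real m"
    using False assms(1) m by (simp add: grid_cell_def field_simps)
  also have "\<dots> \<longleftrightarrow> \<lceil>real n * x\<rceil> = int m"
    by (auto simp: ceiling_eq_iff)
  also have "\<dots> \<longleftrightarrow> cell_index n x = m"
    using m(1) unfolding cell_index_def by linarith
  finally show ?thesis .
qed

text \<open>The grid point is the right endpoint of its cell and belongs to it, so sampling there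
  reads off the value on cell \<open>m\<close>.\<close>

lemma cell_index_grid_point:
  assumes "m \<in> {1..n}"
  shows "cell_index n (real m / real n) = m"
  using assms by (simp add: cell_index_def)

lemma grid_cell_subset:
  assumes "m \<in> {1..n}"
  shows "grid_cell n m \<subseteq> {0..1}"
proof -
  have "real m / real n \<le> 1" "1 / real n \<le> 1"
    using assms by (auto simp: field_simps)
  moreover have "0 \<le> x" if "real (m - 1) / real n < x" for x
    using that by (rule order.trans[OF divide_nonneg_nonneg less_imp_le, rotated 2]) auto
  ultimately show ?thesis
    by (auto simp: grid_cell_def)
qed

lemma grid_cell_sets: "m \<in> {1..n} \<Longrightarrow> grid_cell n m \<in> sets unit_interval"
  using grid_cell_subset[of m n] by (auto simp: sets_restrict_space_iff grid_cell_def)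

lemma measure_grid_cell:
  assumes "m \<in> {1..n}"
  shows "measure unit_interval (grid_cell n m) = 1 / real n"
proof -
  have "measure unit_interval (grid_cell n m) = measure lborel (grid_cell n m)"
    using grid_cell_subset[OF assms] by (intro measure_restrict_space) auto
  also have "\<dots> = 1 / real n"
    using assms by (auto simp: grid_cell_def divide_simps)
  finally show ?thesis .
qed

section \<open>Volumes of grid boxes and integrals of step functions\<close>

lemma prob_space_unit_interval: "prob_space unit_interval"
  by (rule prob_spaceI) (simp add: emeasure_restrict_space)

lemma product_prob_space_unit_interval: "product_prob_space (\<lambda>_. unit_interval)"
proof -
  interpret prob_space unit_interval
    by (rule prob_space_unit_interval)
  show ?thesis
    by unfold_locales
qed

lemma finite_product_prob_space_unit_interval:
  "finite B \<Longrightarrow> finite_product_prob_space (\<lambda>_. unit_interval) B"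
  by (intro finite_product_prob_space.intro finite_product_sigma_finite.intro
      finite_product_sigma_finite_axioms.intro product_prob_space_unit_interval
      product_prob_space.axioms(1)[OF product_prob_space_unit_interval])

lemma measure_grid_box:
  assumes "finite B" and "m \<in> B \<rightarrow>\<^sub>E {1..n}"
  shows "measure (PiM B (\<lambda>_. unit_interval)) (\<Pi>\<^sub>E b\<in>B. grid_cell n (m b)) = (1 / real n) ^ card B"
proof -
  interpret finite_product_prob_space "\<lambda>_. unit_interval" B
    by (rule finite_product_prob_space_unit_interval) (rule assms(1))
  have "measure (PiM B (\<lambda>_. unit_interval)) (\<Pi>\<^sub>E b\<in>B. grid_cell n (m b)) =
      (\<Prod>b\<in>B. measure unit_interval (grid_cell n (m b)))"
    using assms(2) by (intro prob_times grid_cell_sets) auto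
  also have "\<dots> = (\<Prod>b\<in>B. 1 / real n)"
    using assms(2) by (intro prod.cong refl measure_grid_cell) auto
  finally show ?thesis by simp
qed

text \<open>On the cube, \<open>g\<close> is the finite sum of \<open>h m\<close> times the
  indicator of box \<open>m\<close>, and every box has volume \<open>(1 / real n) ^ card B\<close>.
  The coordinates are indexed by an arbitrary finite set because the integral in
  \<open>T_cont\<close> runs over blocks.\<close>

lemma integral_step_function:
  fixes g :: "('i \<Rightarrow> real) \<Rightarrow> real"
  assumes "finite B" and "n \<ge> 1"
    and step: "\<And>z. z \<in> B \<rightarrow>\<^sub>E {0..1} \<Longrightarrow> g z = h (\<lambda>b\<in>B. cell_index n (z b))"
  shows "(\<integral>z. g z \<partial>PiM B (\<lambda>_. unit_interval)) = (\<Sum>m\<in>B \<rightarrow>\<^sub>E {1..n}. h m) / real n ^ card B"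
proof -
  let ?M = "PiM B (\<lambda>_. unit_interval)"
  let ?box = "\<lambda>m. \<Pi>\<^sub>E b\<in>B. grid_cell n (m b)"
  interpret finite_product_prob_space "\<lambda>_. unit_interval" B
    by (rule finite_product_prob_space_unit_interval) (rule assms(1))
  have fin: "finite (B \<rightarrow>\<^sub>E {1..n})"
    using assms(1) by (intro finite_PiE) auto
  have box_sets: "?box m \<in> sets ?M" if "m \<in> B \<rightarrow>\<^sub>E {1..n}" for m
    using that assms(1) by (intro sets_PiM_I_finite grid_cell_sets) auto
  have "g z = (\<Sum>m\<in>B \<rightarrow>\<^sub>E {1..n}. h m * indicator (?box m) z)" if "z \<in> space ?M" for z
  proof -
    \<comment> \<open>The multi-index of the only grid box containing \<open>z\<close>; all other
      summands vanish at \<open>z\<close>.\<close>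
    define m' where "m' = (\<lambda>b\<in>B. cell_index n (z b))"
    have z: "z \<in> B \<rightarrow>\<^sub>E {0..1}"
      using that by (simp add: space_PiM)
    then have m: "m' \<in> B \<rightarrow>\<^sub>E {1..n}"
      using cell_index_in_range[OF assms(2)] by (auto simp: m'_def PiE_iff)
    have "z \<in> ?box m \<longleftrightarrow> m = m'" if "m \<in> B \<rightarrow>\<^sub>E {1..n}" for m
    proof -
      have "z \<in> ?box m \<longleftrightarrow> (\<forall>b\<in>B. cell_index n (z b) = m b)"
        using z that mem_grid_cell_iff[OF assms(2)] by (auto simp: PiE_iff)
      also have "\<dots> \<longleftrightarrow> m = m'"
        using that by (auto simp: m'_def PiE_iff extensional_def fun_eq_iff)
      finally show ?thesis .
    qed
    then have "h m * indicator (?box m) z = (if m = m' then h m else 0)"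
      if "m \<in> B \<rightarrow>\<^sub>E {1..n}" for m
      using that unfolding indicator_def by simp
    then have "(\<Sum>m\<in>B \<rightarrow>\<^sub>E {1..n}. h m * indicator (?box m) z) =
        (\<Sum>m\<in>B \<rightarrow>\<^sub>E {1..n}. if m = m' then h m else 0)"
      by (intro sum.cong refl)
    also have "\<dots> = h m'"
      using fin m by simp
    finally show ?thesis
      using step[OF z] by (simp add: m'_def)
  qed
  then have "(\<integral>z. g z \<partial>?M) = (\<integral>z. (\<Sum>m\<in>B \<rightarrow>\<^sub>E {1..n}. h m * indicator (?box m) z) \<partial>?M)"
    by (intro Bochner_Integration.integral_cong) auto
  also have "\<dots> = (\<Sum>m\<in>B \<rightarrow>\<^sub>E {1..n}. \<integral>z. h m * indicator (?box m) z \<partial>?M)"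
    using box_sets by (intro Bochner_Integration.integral_sum integrable_mult_right
        integrable_real_indicator) (auto simp: less_top[symmetric])
  also have "\<dots> = (\<Sum>m\<in>B \<rightarrow>\<^sub>E {1..n}. h m * (1 / real n) ^ card B)"
  proof (rule sum.cong)
    fix m assume m: "m \<in> B \<rightarrow>\<^sub>E {1..n}"
    then have "?box m \<inter> space ?M = ?box m"
      using sets.sets_into_space[OF box_sets] by blast
    then show "(\<integral>z. h m * indicator (?box m) z \<partial>?M) = h m * (1 / real n) ^ card B"
      using measure_grid_box[OF assms(1) m] by simp
  qed simp
  finally show ?thesis
    by (simp add: sum_divide_distrib power_one_over)
qed

section \<open>Null operators\<close>

text \<open>By Fubini: once all coordinates except \<open>j\<close> are fixed, the slice of the
  diagonal is at most one point, a Lebesgue null set.\<close>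

lemma AE_cube_coords_distinct:
  assumes "j < l" and "j' < l" and "j \<noteq> j'"
  shows "AE y in cube l. y j \<noteq> y j'"
proof -
  let ?I = "{..<l} - {j}"
  let ?D = "{y \<in> space (cube l). y j = y j'}"
  have ins: "{..<l} = insert j ?I" "j' \<in> ?I"
    using assms by auto
  have coord: "(\<lambda>y. y i) \<in> borel_measurable (cube l)" if "i < l" for i
  proof -
    have "(\<lambda>y. y i) \<in> measurable (cube l) unit_interval"
      unfolding cube_def using that by (intro measurable_component_singleton) auto
    moreover have "(\<lambda>x. x) \<in> borel_measurable unit_interval"
      by (simp add: measurable_restrict_space1)
    ultimately show ?thesis
      using measurable_compose by blast
  qed
  have D: "?D \<in> sets (cube l)"
    using coord assms(1,2) by measurable
  have cube: "cube l = PiM (insert j ?I) (\<lambda>_. unit_interval)"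
    unfolding cube_def ins(1)[symmetric] ..
  have "emeasure (cube l) ?D = (\<integral>\<^sup>+y. indicator ?D y \<partial>cube l)"
    using D by simp
  also have "\<dots> = (\<integral>\<^sup>+x. (\<integral>\<^sup>+t. indicator ?D (x(j := t)) \<partial>unit_interval)
      \<partial>PiM ?I (\<lambda>_. unit_interval))"
    using borel_measurable_indicator[OF D] unfolding cube
    by (intro product_sigma_finite.product_nn_integral_insert
        [OF product_prob_space.axioms(1)[OF product_prob_space_unit_interval]]) auto
  also have "\<dots> = (\<integral>\<^sup>+x. 0 \<partial>PiM ?I (\<lambda>_. unit_interval))"
  proof (rule nn_integral_cong)
    fix x assume "x \<in> space (PiM ?I (\<lambda>_. unit_interval))"
    then have x: "x j' \<in> {0..1}"
      using PiE_mem[of x ?I "\<lambda>_. {0..1}", OF _ ins(2)] by (simp add: space_PiM)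
    \<comment> \<open>Since \<open>j \<noteq> j'\<close>, the update at \<open>j\<close> leaves
      \<open>x j'\<close> unchanged, so a point of the slice must have
      \<open>t = x j'\<close>.\<close>
    have "(\<integral>\<^sup>+t. indicator ?D (x(j := t)) \<partial>unit_interval) \<le>
        (\<integral>\<^sup>+t. indicator {x j'} t \<partial>unit_interval)"
      using assms(3) by (intro nn_integral_mono) (auto simp: indicator_def)
    also have "\<dots> = emeasure unit_interval {x j'}"
      using x by (intro nn_integral_indicator) (auto simp: sets_restrict_space_iff)
    also have "\<dots> = 0"
      using x by (simp add: emeasure_restrict_space)
    finally show "(\<integral>\<^sup>+t. indicator ?D (x(j := t)) \<partial>unit_interval) = 0"
      by simp
  qed
  finally have "emeasure (cube l) ?D = 0"
    by simp
  then show ?thesis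
    using D by (intro AE_I[of _ _ ?D]) auto
qed

text \<open>Almost every \<open>y\<close> has distinct coordinates \<open>j\<close> and
  \<open>j'\<close> and so falls into the zero branch of \<open>T_formula\<close>. The
  contrapositive is what matters later: a non-null \<gamma> has at most one output axis per
  block.\<close>

lemma null_operator_if_outputs_share_block:
  assumes "A \<in> \<gamma>" and "j < l" and "j' < l" and "j \<noteq> j'" and "k + j \<in> A" and "k + j' \<in> A"
  shows "null_operator k l \<gamma>"
  unfolding null_operator_def
proof
  fix U
  show "AE y in cube l. T_cont k l \<gamma> U y = 0"
    using AE_cube_coords_distinct[OF assms(2-4)]
  proof eventually_elim
    case (elim y)
    then show ?case
      using assms unfolding T_cont_def T_formula_def by auto
  qed
qed

section \<open>Commutation with sampling\<close>

text \<open>The invariant carried through the network: \<open>U\<close> is the step function with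
  value \<open>V m\<close> on grid box \<open>m\<close>. Agreement at grid points alone would be too
  weak, since the integral in \<open>T_cont\<close> sees whole cells.\<close>

definition step_of :: "nat \<Rightarrow> nat \<Rightarrow> ((nat \<Rightarrow> real) \<Rightarrow> real) \<Rightarrow> ((nat \<Rightarrow> nat) \<Rightarrow> real) \<Rightarrow> bool" where
  "step_of n k U V \<longleftrightarrow>
     (\<forall>x\<in>{..<k} \<rightarrow>\<^sub>E {0..1}. U x = V (\<lambda>a\<in>{..<k}. cell_index n (x a)))"

lemma block_of_mem:
  assumes "partition_on S \<gamma>" and "i \<in> S"
  shows "block_of \<gamma> i \<in> \<gamma>" and "i \<in> block_of \<gamma> i"
proof -
  obtain A where A: "A \<in> \<gamma>" "i \<in> A"
    using assms partition_onD1 by blast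
  moreover have "B = A" if "B \<in> \<gamma>" "i \<in> B" for B
    using disjointD[OF partition_onD2[OF assms(1)] that(1) A(1)] that(2) A(2) by blast
  ultimately have "\<exists>!A. A \<in> \<gamma> \<and> i \<in> A"
    by blast
  then have "block_of \<gamma> i \<in> \<gamma> \<and> i \<in> block_of \<gamma> i"
    unfolding block_of_def by (rule theI')
  then show "block_of \<gamma> i \<in> \<gamma>" "i \<in> block_of \<gamma> i"
    by auto
qed

text \<open>A block that is not an input block contains an output axis, so the \<open>LEAST\<close>
  in \<open>glue\<close> is attained and names a genuine coordinate of \<open>y\<close>.\<close>

lemma Least_output_less:
  assumes "partition_on {..<k + l} \<gamma>" and "i < k" and "block_of \<gamma> i \<notin> input_blocks k \<gamma>"
  shows "(LEAST j. k + j \<in> block_of \<gamma> i) < l"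
proof -
  have mem: "block_of \<gamma> i \<in> \<gamma>"
    using assms(1,2) by (intro block_of_mem) auto
  then obtain a where "a \<in> block_of \<gamma> i" "\<not> a < k"
    using assms(3) by (auto simp: input_blocks_def)
  then have "k + (a - k) \<in> block_of \<gamma> i"
    by simp
  then have "k + (LEAST j. k + j \<in> block_of \<gamma> i) \<in> block_of \<gamma> i"
    by (rule LeastI)
  then have "k + (LEAST j. k + j \<in> block_of \<gamma> i) \<in> {..<k + l}"
    using mem partition_onD1[OF assms(1)] by blast
  then show ?thesis
    by simp
qed

text \<open>For fixed \<open>y\<close> the integrand is a step function of \<open>z\<close>, so its
  integral is the discrete average. The hypothesis \<open>sep\<close> excludes the diagonal
  condition, which cells do not respect: distinct points of one cell have equal indices.\<close>

lemma step_of_T: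
  assumes part: "partition_on {..<k + l} \<gamma>" and n: "n \<ge> 1" and UV: "step_of n k U V"
    and sep: "\<And>A j j'. A \<in> \<gamma> \<Longrightarrow> j < l \<Longrightarrow> j' < l \<Longrightarrow> k + j \<in> A \<Longrightarrow> k + j' \<in> A \<Longrightarrow> j = j'"
  shows "step_of n l (T_cont k l \<gamma> U) (T_disc n k l \<gamma> V)"
  unfolding step_of_def
proof
  fix y :: "nat \<Rightarrow> real" assume y: "y \<in> {..<l} \<rightarrow>\<^sub>E {0..1}"
  let ?y = "\<lambda>a\<in>{..<l}. cell_index n (y a)"
  let ?B = "input_blocks k \<gamma>"
  have fin: "finite ?B"
    using finite_elements[OF _ part] by (simp add: input_blocks_def)
  have "(\<integral>z. U (glue k \<gamma> z y) \<partial>PiM ?B (\<lambda>_. unit_interval)) =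
      (\<Sum>z\<in>?B \<rightarrow>\<^sub>E {1..n}. V (glue k \<gamma> z ?y)) / real n ^ card ?B"
  proof (rule integral_step_function[OF fin n])
    fix z :: "nat set \<Rightarrow> real" assume z: "z \<in> ?B \<rightarrow>\<^sub>E {0..1}"
    let ?z = "\<lambda>b\<in>?B. cell_index n (z b)"
    have "glue k \<gamma> z y \<in> {..<k} \<rightarrow>\<^sub>E {0..1}"
      using y z Least_output_less[OF part] by (auto simp: glue_def PiE_iff)
    \<comment> \<open>\<open>glue\<close> only copies coordinates, so it commutes with passing to
      cell indices. Input axes sharing a block just receive the same copy.\<close>
    moreover have "(\<lambda>i\<in>{..<k}. cell_index n (glue k \<gamma> z y i)) = glue k \<gamma> ?z ?y"
      using Least_output_less[OF part] by (auto simp: glue_def fun_eq_iff)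
    ultimately show "U (glue k \<gamma> z y) = V (glue k \<gamma> ?z ?y)"
      using UV by (simp add: step_of_def)
  qed
  \<comment> \<open>By \<open>sep\<close> both formulas take the averaging branch.\<close>
  moreover have "\<not> (\<exists>A\<in>\<gamma>. \<exists>j<l. \<exists>j'<l. k + j \<in> A \<and> k + j' \<in> A \<and> y j \<noteq> y j')"
    "\<not> (\<exists>A\<in>\<gamma>. \<exists>j<l. \<exists>j'<l. k + j \<in> A \<and> k + j' \<in> A \<and> ?y j \<noteq> ?y j')"
    using sep by blast+
  ultimately show "T_cont k l \<gamma> U y = T_disc n k l \<gamma> V ?y"
    unfolding T_cont_def T_disc_def T_formula_def by (simp only: if_False)
qed

text \<open>Term by term: a null operator has coefficient 0, and any other satisfies the separation
  hypothesis of \<open>step_of_T\<close>.\<close>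

lemma step_of_lin_comb:
  assumes "n \<ge> 1" and "step_of n k U V"
    and null: "\<And>\<gamma>. partition_on {..<k + l} \<gamma> \<Longrightarrow> null_operator k l \<gamma> \<Longrightarrow> c \<gamma> = 0"
  shows "step_of n l (lin_comb T_cont k l c U) (lin_comb (T_disc n) k l c V)"
  unfolding step_of_def lin_comb_def
proof (intro ballI sum.cong refl)
  fix y :: "nat \<Rightarrow> real" and \<gamma>
  assume y: "y \<in> {..<l} \<rightarrow>\<^sub>E {0..1}" and "\<gamma> \<in> {\<gamma>. partition_on {..<k + l} \<gamma>}"
  then have part: "partition_on {..<k + l} \<gamma>"
    by simp
  show "c \<gamma> * T_cont k l \<gamma> U y = c \<gamma> * T_disc n k l \<gamma> V (\<lambda>a\<in>{..<l}. cell_index n (y a))"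
  proof (cases "null_operator k l \<gamma>")
    case True
    then show ?thesis
      using null[OF part] by simp
  next
    case False
    then have "step_of n l (T_cont k l \<gamma> U) (T_disc n k l \<gamma> V)"
      using null_operator_if_outputs_share_block
      by (intro step_of_T[OF part assms(1,2)]) blast
    then show ?thesis
      using y by (simp add: step_of_def)
  qed
qed

section \<open>Layers and whole networks\<close>

lemma step_of_layer:
  assumes "n \<ge> 1"
    and U: "\<And>j. j < width N (s - 1) \<Longrightarrow> step_of n (order N (s - 1)) (U j) (V j)"
    and w: "\<And>j. j < width N (s - 1) \<Longrightarrow>
      expansion_in_LE (order N (s - 1)) (order N s) (weight N s i j)"
    and b: "expansion_in_LE 0 (order N s) (bias N s i)"
  shows "step_of n (order N s) (layer T_cont N s U i) (layer (T_disc n) N s V i)"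
proof -
  have "step_of n (order N s)
      (lin_comb T_cont (order N (s - 1)) (order N s) (weight N s i j) (U j))
      (lin_comb (T_disc n) (order N (s - 1)) (order N s) (weight N s i j) (V j))"
    if "j < width N (s - 1)" for j
    using U[OF that] w[OF that] by (intro step_of_lin_comb assms(1)) (auto simp: expansion_in_LE_def)
  \<comment> \<open>The bias is the case without input axes: the constant 1 on the one-point cube is
    the step function of the discrete constant 1.\<close>
  moreover have "step_of n (order N s) (lin_comb T_cont 0 (order N s) (bias N s i) (\<lambda>_. 1))
      (lin_comb (T_disc n) 0 (order N s) (bias N s i) (\<lambda>_. 1))"
    using b by (intro step_of_lin_comb assms(1)) (auto simp: expansion_in_LE_def step_of_def)
  ultimately show ?thesis
    by (simp add: step_of_def layer_def)
qed

text \<open>Induction on the number of layers. Applying \<rho> to the values of a step function and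
  of its discrete counterpart preserves \<open>step_of\<close>.\<close>

lemma step_of_forward:
  assumes "N \<in> IWN" and "n \<ge> 1" and "\<And>j. j < 2 \<Longrightarrow> step_of n 2 (U j) (V j)"
  shows "s \<le> depth N \<Longrightarrow> i < width N s \<Longrightarrow>
    step_of n (order N s) (forward T_cont \<rho> N s U i) (forward (T_disc n) \<rho> N s V i)"
proof (induction s arbitrary: i)
  case 0
  then show ?case
    using assms(1,3) by (auto simp: IWN_def continuous_IGN_def)
next
  case (Suc s)
  have exp: "\<And>j. j < width N s \<Longrightarrow>
      expansion_in_LE (order N s) (order N (Suc s)) (weight N (Suc s) i j)"
    "expansion_in_LE 0 (order N (Suc s)) (bias N (Suc s) i)"
    using assms(1) Suc.prems unfolding IWN_def by force+
  show ?case
  \<comment> \<open>\<open>forward\<close> applies no nonlinearity before the first layer, so that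
    layer is treated separately.\<close>
  proof (cases s)
    case 0
    then show ?thesis
      using Suc exp by (auto intro!: step_of_layer assms(2))
  next
    case (Suc s')
    have "step_of n (order N s) (\<lambda>y. \<rho> (forward T_cont \<rho> N s U j y))
        (\<lambda>y. \<rho> (forward (T_disc n) \<rho> N s V j y))" if "j < width N s" for j
      using Suc.IH[OF _ that] Suc.prems(1) by (simp add: step_of_def)
    then show ?thesis
      using exp unfolding Suc forward.simps by (intro step_of_layer assms(2)) auto
  qed
qed

section \<open>Sampling and step function inputs\<close>

lemma step_of_sample:
  assumes "n \<ge> 1" and "regular_step n k (U i)"
  shows "step_of n k (U i) (sample n k U i)"
  unfolding step_of_def
proof
  fix x :: "nat \<Rightarrow> real" assume x: "x \<in> {..<k} \<rightarrow>\<^sub>E {0..1}"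
  let ?m = "\<lambda>a\<in>{..<k}. cell_index n (x a)"
  let ?p = "\<lambda>a\<in>{..<k}. real (?m a) / real n"
  have m: "?m \<in> {..<k} \<rightarrow>\<^sub>E {1..n}"
    using x cell_index_in_range[OF assms(1)] by (auto simp: PiE_iff)
  \<comment> \<open>Both \<open>x\<close> and the grid point \<open>?p\<close> with the same indices
    lie in one box, on which \<open>U i\<close> is constant.\<close>
  have "x \<in> (\<Pi>\<^sub>E a\<in>{..<k}. grid_cell n (?m a))"
    using x m mem_grid_cell_iff[OF assms(1)] by (auto simp: PiE_iff)
  moreover have "?p \<in> (\<Pi>\<^sub>E a\<in>{..<k}. grid_cell n (?m a))"
  proof (intro PiE_I)
    fix a assume "a \<in> {..<k}"
    then have a: "?m a \<in> {1..n}" and p: "?p a = real (?m a) / real n"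
      using m by (auto simp: PiE_iff)
    have "real (?m a) / real n \<in> {0..1}"
      using a by (auto simp: divide_simps)
    then show "?p a \<in> grid_cell n (?m a)"
      unfolding p using mem_grid_cell_iff[OF assms(1) _ a] cell_index_grid_point[OF a] by blast
  qed auto
  ultimately show "U i x = sample n k U i ?m"
    using assms(2) m unfolding regular_step_def sample_def by metis
qed

lemma regular_step_input:
  assumes "regular_step n 2 (\<lambda>x. W (x 0) (x 1))" and "regular_step n 1 (\<lambda>x. f (x 0))"
  shows "regular_step n 2 (input (W, f) i)"
proof (cases "i = 0")
  case True
  then show ?thesis
    using assms(1) by (simp add: input_def)
next
  case False
  show ?thesis
    unfolding regular_step_def
  proof
    fix m :: "nat \<Rightarrow> nat" assume m: "m \<in> {..<2} \<rightarrow>\<^sub>E {1..n}"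
    \<comment> \<open>The signal component ignores the second coordinate, so its value on a square
      cell comes from the interval cell of the first axis.\<close>
    then have "restrict m {..<1} \<in> {..<1} \<rightarrow>\<^sub>E {1..n}"
      by (auto simp: PiE_iff)
    from bspec[OF assms(2)[unfolded regular_step_def] this]
    obtain c where c: "\<forall>x\<in>(\<Pi>\<^sub>E a\<in>{..<1}. grid_cell n (restrict m {..<1} a)). f (x 0) = c" ..
    have "f (x 0) = c" if "x \<in> (\<Pi>\<^sub>E a\<in>{..<2}. grid_cell n (m a))" for x
      using bspec[OF c, of "restrict x {..<1}"] that by (auto simp: PiE_iff)
    then show "\<exists>c. \<forall>x\<in>(\<Pi>\<^sub>E a\<in>{..<2}. grid_cell n (m a)). input (W, f) i x = c"
      using False by (auto simp: input_def)
  qed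
qed

text \<open>The grid point with multi-index \<open>m\<close> lies in box \<open>m\<close>, so
  evaluating \<open>step_of\<close> there returns \<open>V m\<close>.\<close>

lemma sample_eq_if_step_of:
  assumes "step_of n k (U i) V" and "m \<in> {..<k} \<rightarrow>\<^sub>E {1..n}"
  shows "sample n k U i m = V m"
proof -
  let ?p = "\<lambda>a\<in>{..<k}. real (m a) / real n"
  have "?p \<in> {..<k} \<rightarrow>\<^sub>E {0..1}"
    using assms(2) by (force simp: PiE_iff divide_simps)
  moreover have "cell_index n (real (m a) / real n) = m a" if "a < k" for a
    using assms(2) that by (intro cell_index_grid_point) (auto simp: PiE_iff)
  then have "(\<lambda>a\<in>{..<k}. cell_index n (?p a)) = m"
    using assms(2) by (auto simp: fun_eq_iff PiE_iff extensional_def)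
  ultimately show ?thesis
    using assms(1) by (simp add: step_of_def sample_def)
qed

theorem proposition4p4:
  fixes \<rho> :: "real \<Rightarrow> real" and r :: real and N :: ign
  assumes "r > 0" and "N \<in> IWN"
  shows "N \<in> IGN_small \<rho> r"
proof -
  have "sample n (order N (depth N)) (ign_map \<rho> N (input (W, f))) i m =
      ign_map_disc n \<rho> N (sample n 2 (input (W, f))) i m"
    if "n \<ge> 1" and "regular_step n 2 (\<lambda>x. W (x 0) (x 1))" and "regular_step n 1 (\<lambda>x. f (x 0))"
      and "i < width N (depth N)" and "m \<in> {..<order N (depth N)} \<rightarrow>\<^sub>E {1..n}" for n W f i m
    unfolding ign_map_def ign_map_disc_def
    \<comment> \<open>The inputs are the step functions of their samples, the network carries this
      relation to the output, and sampling the output then gives the discrete values.\<close>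
    using that by (intro sample_eq_if_step_of step_of_forward[OF assms(2)] step_of_sample
        regular_step_input) auto
  then show ?thesis
    using assms(2) unfolding IGN_small_def IWN_def by blast
qed

end
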